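(* Let $(K,A,\circ)$ be a crossed semi-bimodule. (i) The multiplication $\bullet$ on the set $A\times K$ given by $$(a,x)\bullet(b,y)=(ab,\ {}^{a}y\,x^{b\circ y})$$ defines a monoid structure on $A\times K$. This monoid is denoted by $A\bowtie K$. (ii) The multiplication on the set $A\times K\times K$ given by $$(a,x,y)\bullet(b,u,v)=(ab,\ {}^{a}u\,x^{b\circ u},\ {}^{a\circ x}v\,y^{b\circ u\circ v})$$ (where $b\circ u\circ v=(b\circ u)\circ v$) defines a monoid structure on $A\times K\times K$. This monoid is denoted by $A\bowtie K\bowtie K$. (iii) Define maps $s^0_0:A\to A\bowtie K$, $s^1_0,s^1_1:A\bowtie K\to A\bowtie K\bowtie K$, $d^1_0,d^1_1:A\bowtie K\to A$ and $d^2_0,d^2_1,d^2_2:A\bowtie K\bowtie K\to A\bowtie K$ by $$s^0_0(a)=(a,1),\quad s^1_0(a,x)=(a,x,1),\quad s^1_1(a,x)=(a,1,x),$$ $$d^1_0(a,x)=a,\quad d^1_1(a,x)=a\circ x,$$ $$d^2_0(a,x,y)=(a,x),\quad d^2_1(a,x,y)=(a,xy),\quad d^2_2(a,x,y)=(a\circ x,y).$$ These maps are monoid homomorphisms and satisfy all the simplicial identities. (iv) The commutative square of monoids with top map $d^2_2:A\bowtie K\bowtie K\to A\bowtie K$, left map $d^2_0:A\bowtie K\bowtie K\to A\bowtie K$, right map $d^1_0:A\bowtie K\to A$ and bottom map $d^1_1:A\bowtie K\to A$ (so $d^1_0d^2_2=d^1_1d^2_0$) is a pullback diagram. (v) The monoids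 $A$, $A\bowtie K$, $A\bowtie K\bowtie K$ together with the homomorphisms $s^0_0$, $s^1_0$, $s^1_1$, $d^1_0$, $d^1_1$, $d^2_0$, $d^2_1$, $d^2_2$ define an internal category, denoted $\mathsf{Cat}(A,K,\circ)$, in the category of monoids, with object of objects $A$, object of morphisms $A\bowtie K$, target $d^1_0$, source $d^1_1$, unit $s^0_0$ and composition $d^2_1:A\bowtie K\bowtie K\to A\bowtie K$.
   Context: A crossed semi-bimodule $(K,A,\circ)$ consists of monoids $A$ and $K$ (written multiplicatively, units denoted $1$), together with maps $A\times K\to A,\ (a,x)\mapsto a\circ x$; $A\times K\to K,\ (a,x)\mapsto {}^{a}x$; $K\times A\to K,\ (x,a)\mapsto x^{a}$, such that: the first map makes $A$ into a right $K$-set ($a\circ 1=a$, $a\circ(xy)=(a\circ x)\circ y$); the second makes $K$ into a left $A$-monoid (a left action of $A$ on $K$ by monoid endomorphisms: ${}^{1}x=x$, ${}^{ab}x={}^{a}({}^{b}x)$, ${}^{a}(xy)={}^{a}x\,{}^{a}y$, ${}^{a}1=1$); the third makes $K$ into a right $A$-monoid ($x^{1}=x$, $x^{ab}=(x^{a})^{b}$, $(xy)^{a}=x^{a}y^{a}$, $1^{a}=1$); and for all $x,y\in K$, $a,b\in A$: (1) $({}^{a}x)^{b}={}^{a}(x^{b})$; (2) $(ab)\circ({}^{a}x)=a(b\circ x)$; (3) $(ab)\circ(x^{b})=(a\circ x)b$; (4) $({}^{a}y)\,x^{b\circ y}=x^{b}\,({}^{a\circ x}y)$. An internal category in a category with finite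 limits consists of objects $C_0$ (object of objects) and $C_1$ (object of morphisms), and morphisms $d^1_0,d^1_1:C_1\to C_0$ (target, source), $s^0_0:C_0\to C_1$ (unit), $d^2_1:C_2\to C_1$ (composite), where $C_2$ is the pullback of $d^1_1:C_1\to C_0$ and $d^1_0:C_1\to C_0$ with projections $d^2_0,d^2_2:C_2\to C_1$ satisfying $d^1_1d^2_0=d^1_0d^2_2$, satisfying the standard simplicial identities (i.e. the usual axioms of a category). The simplicial identities are $d_id_j=d_{j-1}d_i$ for $i<j$; $s_is_j=s_{j+1}s_i$ for $i\le j$; $d_is_j=s_{j-1}d_i$ for $i<j$, $d_is_j=\mathrm{id}$ for $i=j,j+1$, $d_is_j=s_jd_{i-1}$ for $i>j+1$. *)

theory Defs
  imports "HOL-Algebra.Group"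
begin

section \<open>The category of monoids\<close>

text \<open>
  The library's \<^const>\<open>hom\<close> does not ask for preservation of the unit.  As everywhere
  in HOL-Algebra, maps are total functions of which only the values on the carrier matter, so
  two homomorphisms out of \<open>M\<close> are equal if they agree on \<open>carrier M\<close>.
\<close>

definition monoid_homs :: "('a, 'm) monoid_scheme \<Rightarrow> ('b, 'n) monoid_scheme \<Rightarrow> ('a \<Rightarrow> 'b) set"
  where "monoid_homs M N = {h \<in> hom M N. h \<one>\<^bsub>M\<^esub> = \<one>\<^bsub>N\<^esub>}"

text \<open>
  The square

    \<open>P --q--> Y\<close>

    \<open>|p       |g\<close>

    \<open>X --f--> Z\<close>

  is a pullback in the category of monoids.  HOL cannot quantify over types inside a formula, so
  the type \<open>'t\<close> of the elements of the test monoids \<open>T\<close> is a parameter; a theorem in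
  which \<open>'t\<close> is a free type variable covers all test monoids.
\<close>

definition monoid_pullback_square ::
    "'t itself \<Rightarrow> ('p, 'i) monoid_scheme \<Rightarrow> ('x, 'j) monoid_scheme \<Rightarrow> ('y, 'l) monoid_scheme \<Rightarrow>
     ('z, 'm) monoid_scheme \<Rightarrow> ('p \<Rightarrow> 'x) \<Rightarrow> ('p \<Rightarrow> 'y) \<Rightarrow> ('x \<Rightarrow> 'z) \<Rightarrow> ('y \<Rightarrow> 'z) \<Rightarrow> bool"
  where
    "monoid_pullback_square _ P X Y Z p q f g \<longleftrightarrow>
       monoid P \<and> monoid X \<and> monoid Y \<and> monoid Z \<and>
       p \<in> monoid_homs P X \<and> q \<in> monoid_homs P Y \<and>
       f \<in> monoid_homs X Z \<and> g \<in> monoid_homs Y Z \<and>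
       (\<forall>w \<in> carrier P. f (p w) = g (q w)) \<and>
       (\<forall>T :: 't monoid. monoid T \<longrightarrow>
         (\<forall>u \<in> monoid_homs T X. \<forall>v \<in> monoid_homs T Y.
           (\<forall>t \<in> carrier T. f (u t) = g (v t)) \<longrightarrow>
           (\<exists>h \<in> monoid_homs T P.
              (\<forall>t \<in> carrier T. p (h t) = u t \<and> q (h t) = v t) \<and>
              (\<forall>h' \<in> monoid_homs T P.
                 (\<forall>t \<in> carrier T. p (h' t) = u t \<and> q (h' t) = v t) \<longrightarrow>
                 (\<forall>t \<in> carrier T. h' t = h t)))))"

definition monoid_pullback ::
    "('x, 'j) monoid_scheme \<Rightarrow> ('y, 'l) monoid_scheme \<Rightarrow> ('x \<Rightarrow> 'z) \<Rightarrow> ('y \<Rightarrow> 'z) \<Rightarrow> ('x \<times> 'y) monoid"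
  where
    "monoid_pullback X Y f g =
       (X \<times>\<times> Y)\<lparr>carrier := {w \<in> carrier (X \<times>\<times> Y). f (fst w) = g (snd w)}\<rparr>"

lemma monoid_pullback_square_monoid_pullback:
  assumes "monoid X" "monoid Y" "monoid Z" "f \<in> monoid_homs X Z" "g \<in> monoid_homs Y Z"
  shows "monoid_pullback_square TYPE('t) (monoid_pullback X Y f g) X Y Z fst snd f g"
proof -
  interpret X: monoid X by fact
  interpret Y: monoid Y by fact
  interpret Z: monoid Z by fact
  have P: "monoid (monoid_pullback X Y f g)"
    using assms(4,5)
    by (intro monoidI)
      (auto simp: monoid_pullback_def DirProd_def monoid_homs_def hom_def X.m_assoc Y.m_assoc)
  have fst: "fst \<in> monoid_homs (monoid_pullback X Y f g) X"
    and snd: "snd \<in> monoid_homs (monoid_pullback X Y f g) Y"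
    by (auto simp: monoid_pullback_def DirProd_def monoid_homs_def hom_def)
  have ex: "\<exists>h \<in> monoid_homs T (monoid_pullback X Y f g).
              (\<forall>t \<in> carrier T. fst (h t) = u t \<and> snd (h t) = v t) \<and>
              (\<forall>h' \<in> monoid_homs T (monoid_pullback X Y f g).
                 (\<forall>t \<in> carrier T. fst (h' t) = u t \<and> snd (h' t) = v t) \<longrightarrow>
                 (\<forall>t \<in> carrier T. h' t = h t))"
    if "u \<in> monoid_homs T X" "v \<in> monoid_homs T Y" "\<forall>t \<in> carrier T. f (u t) = g (v t)"
    for T :: "'t monoid" and u v
    using that
    by (intro bexI[of _ "\<lambda>t. (u t, v t)"])
      (auto simp: monoid_pullback_def DirProd_def monoid_homs_def hom_def Pi_iff prod_eq_iff)
  show ?thesis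
    unfolding monoid_pullback_square_def
    using assms P fst snd ex by (auto simp: monoid_pullback_def)
qed


section \<open>Internal categories in the category of monoids\<close>

text \<open>
  In the names of the face maps \<open>d\<close> and the degeneracy maps \<open>s\<close> the first digit is
  the superscript, i.e. the degree of the domain, and the second digit is the subscript.  The identities below are all instances of
  \<open>d\<^sub>i d\<^sub>j = d\<^sub>j\<^sub>-\<^sub>1 d\<^sub>i\<close> (\<open>i < j\<close>), \<open>s\<^sub>i s\<^sub>j = s\<^sub>j\<^sub>+\<^sub>1 s\<^sub>i\<close> (\<open>i \<le> j\<close>),
  \<open>d\<^sub>i s\<^sub>j = s\<^sub>j\<^sub>-\<^sub>1 d\<^sub>i\<close> (\<open>i < j\<close>), \<open>d\<^sub>i s\<^sub>j = id\<close> (\<open>i = j, j + 1\<close>) and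
  \<open>d\<^sub>i s\<^sub>j = s\<^sub>j d\<^sub>i\<^sub>-\<^sub>1\<close> (\<open>i > j + 1\<close>) in degrees at most two.
\<close>

definition simplicial_identities ::
    "('a, 'i) monoid_scheme \<Rightarrow> ('b, 'j) monoid_scheme \<Rightarrow> ('c, 'l) monoid_scheme \<Rightarrow>
     ('a \<Rightarrow> 'b) \<Rightarrow> ('b \<Rightarrow> 'c) \<Rightarrow> ('b \<Rightarrow> 'c) \<Rightarrow>
     ('b \<Rightarrow> 'a) \<Rightarrow> ('b \<Rightarrow> 'a) \<Rightarrow> ('c \<Rightarrow> 'b) \<Rightarrow> ('c \<Rightarrow> 'b) \<Rightarrow> ('c \<Rightarrow> 'b) \<Rightarrow> bool"
  where
    "simplicial_identities C0 C1 C2 s00 s10 s11 d10 d11 d20 d21 d22 \<longleftrightarrow>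
       (\<forall>w \<in> carrier C2.
          d10 (d21 w) = d10 (d20 w) \<and>
          d10 (d22 w) = d11 (d20 w) \<and>
          d11 (d22 w) = d11 (d21 w)) \<and>
       (\<forall>a \<in> carrier C0.
          s10 (s00 a) = s11 (s00 a) \<and>
          d10 (s00 a) = a \<and>
          d11 (s00 a) = a) \<and>
       (\<forall>f \<in> carrier C1.
          d20 (s11 f) = s00 (d10 f) \<and>
          d20 (s10 f) = f \<and>
          d21 (s10 f) = f \<and>
          d21 (s11 f) = f \<and>
          d22 (s11 f) = f \<and>
          d22 (s10 f) = s00 (d11 f))"

text \<open>
  The object \<open>C3\<close> of composable triples is the pullback of \<open>d22\<close> and \<open>d20\<close>; an
  element \<open>(v, w)\<close> of it is a triple with first two members \<open>v\<close> and last two members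
  \<open>w\<close>, so that \<open>fst\<close> and \<open>snd\<close> are its faces \<open>d30\<close> and \<open>d33\<close>.
  The other two faces, which compose the last (\<open>d31\<close>) respectively the first (\<open>d32\<close>)
  two members of a triple, are determined by the identities for \<open>d20\<close> and \<open>d22\<close>
  because \<open>C2\<close> is a pullback.  The equation \<open>d21 d32 = d21 d31\<close> is the associative law.
\<close>

definition composition_assoc ::
    "('c, 'l) monoid_scheme \<Rightarrow> ('c \<Rightarrow> 'b) \<Rightarrow> ('c \<Rightarrow> 'b) \<Rightarrow> ('c \<Rightarrow> 'b) \<Rightarrow> bool"
  where
    "composition_assoc C2 d20 d21 d22 \<longleftrightarrow>
       (let C3 = monoid_pullback C2 C2 d22 d20; d30 = fst; d33 = snd in
        \<exists>d31 \<in> monoid_homs C3 C2. \<exists>d32 \<in> monoid_homs C3 C2.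
          \<forall>w \<in> carrier C3.
            d20 (d31 w) = d20 (d30 w) \<and>
            d20 (d32 w) = d21 (d30 w) \<and>
            d20 (d33 w) = d22 (d30 w) \<and>
            d21 (d32 w) = d21 (d31 w) \<and>
            d21 (d33 w) = d22 (d31 w) \<and>
            d22 (d33 w) = d22 (d32 w))"

text \<open>
  Object of objects \<open>C0\<close>, object of morphisms \<open>C1\<close>, object of composable pairs
  \<open>C2\<close>, target \<open>d10\<close>, source \<open>d11\<close>, unit \<open>s00\<close> and composition \<open>d21\<close>.
  The unit laws are the identities for \<open>d21 s10\<close> and \<open>d21 s11\<close>.
\<close>

definition internal_category_in_monoids ::
    "'t itself \<Rightarrow> ('a, 'i) monoid_scheme \<Rightarrow> ('b, 'j) monoid_scheme \<Rightarrow> ('c, 'l) monoid_scheme \<Rightarrow>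
     ('a \<Rightarrow> 'b) \<Rightarrow> ('b \<Rightarrow> 'c) \<Rightarrow> ('b \<Rightarrow> 'c) \<Rightarrow>
     ('b \<Rightarrow> 'a) \<Rightarrow> ('b \<Rightarrow> 'a) \<Rightarrow> ('c \<Rightarrow> 'b) \<Rightarrow> ('c \<Rightarrow> 'b) \<Rightarrow> ('c \<Rightarrow> 'b) \<Rightarrow> bool"
  where
    "internal_category_in_monoids t C0 C1 C2 s00 s10 s11 d10 d11 d20 d21 d22 \<longleftrightarrow>
       monoid C0 \<and> monoid C1 \<and> monoid C2 \<and>
       s00 \<in> monoid_homs C0 C1 \<and> s10 \<in> monoid_homs C1 C2 \<and> s11 \<in> monoid_homs C1 C2 \<and>
       d10 \<in> monoid_homs C1 C0 \<and> d11 \<in> monoid_homs C1 C0 \<and>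
       d20 \<in> monoid_homs C2 C1 \<and> d21 \<in> monoid_homs C2 C1 \<and> d22 \<in> monoid_homs C2 C1 \<and>
       monoid_pullback_square t C2 C1 C1 C0 d20 d22 d11 d10 \<and>
       simplicial_identities C0 C1 C2 s00 s10 s11 d10 d11 d20 d21 d22 \<and>
       composition_assoc C2 d20 d21 d22"


section \<open>Crossed semi-bimodules\<close>

text \<open>
  \<open>circ a x\<close> is \<open>a \<circ> x\<close>, \<open>lact a x\<close> is \<open>\<^sup>ax\<close> and \<open>ract x a\<close> is \<open>x\<^sup>a\<close>.
\<close>

locale right_monoid_set = K: monoid K
  for S :: "'a set" and K :: "('k, 'n) monoid_scheme" and circ :: "'a \<Rightarrow> 'k \<Rightarrow> 'a" +
  assumes circ_closed: "\<lbrakk>a \<in> S; x \<in> carrier K\<rbrakk> \<Longrightarrow> circ a x \<in> S"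
    and circ_one: "a \<in> S \<Longrightarrow> circ a \<one>\<^bsub>K\<^esub> = a"
    and circ_mult: "\<lbrakk>a \<in> S; x \<in> carrier K; y \<in> carrier K\<rbrakk> \<Longrightarrow>
      circ a (x \<otimes>\<^bsub>K\<^esub> y) = circ (circ a x) y"

locale left_acted_monoid = A: monoid A + K: monoid K
  for A :: "('a, 'm) monoid_scheme" and K :: "('k, 'n) monoid_scheme"
    and lact :: "'a \<Rightarrow> 'k \<Rightarrow> 'k" +
  assumes lact_closed: "\<lbrakk>a \<in> carrier A; x \<in> carrier K\<rbrakk> \<Longrightarrow> lact a x \<in> carrier K"
    and lact_one_left: "x \<in> carrier K \<Longrightarrow> lact \<one>\<^bsub>A\<^esub> x = x"
    and lact_mult_left: "\<lbrakk>a \<in> carrier A; b \<in> carrier A; x \<in> carrier K\<rbrakk> \<Longrightarrow>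
      lact (a \<otimes>\<^bsub>A\<^esub> b) x = lact a (lact b x)"
    and lact_mult: "\<lbrakk>a \<in> carrier A; x \<in> carrier K; y \<in> carrier K\<rbrakk> \<Longrightarrow>
      lact a (x \<otimes>\<^bsub>K\<^esub> y) = lact a x \<otimes>\<^bsub>K\<^esub> lact a y"
    and lact_one: "a \<in> carrier A \<Longrightarrow> lact a \<one>\<^bsub>K\<^esub> = \<one>\<^bsub>K\<^esub>"

locale right_acted_monoid = A: monoid A + K: monoid K
  for A :: "('a, 'm) monoid_scheme" and K :: "('k, 'n) monoid_scheme"
    and ract :: "'k \<Rightarrow> 'a \<Rightarrow> 'k" +
  assumes ract_closed: "\<lbrakk>x \<in> carrier K; a \<in> carrier A\<rbrakk> \<Longrightarrow> ract x a \<in> carrier K"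
    and ract_one_right: "x \<in> carrier K \<Longrightarrow> ract x \<one>\<^bsub>A\<^esub> = x"
    and ract_mult_right: "\<lbrakk>x \<in> carrier K; a \<in> carrier A; b \<in> carrier A\<rbrakk> \<Longrightarrow>
      ract x (a \<otimes>\<^bsub>A\<^esub> b) = ract (ract x a) b"
    and ract_mult: "\<lbrakk>x \<in> carrier K; y \<in> carrier K; a \<in> carrier A\<rbrakk> \<Longrightarrow>
      ract (x \<otimes>\<^bsub>K\<^esub> y) a = ract x a \<otimes>\<^bsub>K\<^esub> ract y a"
    and ract_one: "a \<in> carrier A \<Longrightarrow> ract \<one>\<^bsub>K\<^esub> a = \<one>\<^bsub>K\<^esub>"

locale crossed_semi_bimodule =
  right_monoid_set "carrier A" K circ + left_acted_monoid A K lact + right_acted_monoid A K ract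
  for A :: "('a, 'm) monoid_scheme" and K :: "('k, 'n) monoid_scheme"
    and circ :: "'a \<Rightarrow> 'k \<Rightarrow> 'a" and lact :: "'a \<Rightarrow> 'k \<Rightarrow> 'k" and ract :: "'k \<Rightarrow> 'a \<Rightarrow> 'k" +
  assumes lact_ract: "\<lbrakk>x \<in> carrier K; a \<in> carrier A; b \<in> carrier A\<rbrakk> \<Longrightarrow>
      ract (lact a x) b = lact a (ract x b)"
    and mult_circ_lact: "\<lbrakk>x \<in> carrier K; a \<in> carrier A; b \<in> carrier A\<rbrakk> \<Longrightarrow>
      circ (a \<otimes>\<^bsub>A\<^esub> b) (lact a x) = a \<otimes>\<^bsub>A\<^esub> circ b x"
    and mult_circ_ract: "\<lbrakk>x \<in> carrier K; a \<in> carrier A; b \<in> carrier A\<rbrakk> \<Longrightarrow>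
      circ (a \<otimes>\<^bsub>A\<^esub> b) (ract x b) = circ a x \<otimes>\<^bsub>A\<^esub> b"
    and interchange:
      "\<lbrakk>x \<in> carrier K; y \<in> carrier K; a \<in> carrier A; b \<in> carrier A\<rbrakk> \<Longrightarrow>
      lact a y \<otimes>\<^bsub>K\<^esub> ract x (circ b y) = ract x b \<otimes>\<^bsub>K\<^esub> lact (circ a x) y"

definition bowtie ::
    "('a, 'm) monoid_scheme \<Rightarrow> ('k, 'n) monoid_scheme \<Rightarrow> ('a \<Rightarrow> 'k \<Rightarrow> 'a) \<Rightarrow> ('a \<Rightarrow> 'k \<Rightarrow> 'k) \<Rightarrow>
     ('k \<Rightarrow> 'a \<Rightarrow> 'k) \<Rightarrow> ('a \<times> 'k) monoid"
  where
    "bowtie A K circ lact ract =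
       \<lparr>carrier = carrier A \<times> carrier K,
        mult = (\<lambda>(a, x) (b, y). (a \<otimes>\<^bsub>A\<^esub> b, lact a y \<otimes>\<^bsub>K\<^esub> ract x (circ b y))),
        one = (\<one>\<^bsub>A\<^esub>, \<one>\<^bsub>K\<^esub>)\<rparr>"

definition bowtie2 ::
    "('a, 'm) monoid_scheme \<Rightarrow> ('k, 'n) monoid_scheme \<Rightarrow> ('a \<Rightarrow> 'k \<Rightarrow> 'a) \<Rightarrow> ('a \<Rightarrow> 'k \<Rightarrow> 'k) \<Rightarrow>
     ('k \<Rightarrow> 'a \<Rightarrow> 'k) \<Rightarrow> ('a \<times> 'k \<times> 'k) monoid"
  where
    "bowtie2 A K circ lact ract =
       \<lparr>carrier = carrier A \<times> carrier K \<times> carrier K,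
        mult = (\<lambda>(a, x, y) (b, u, v).
          (a \<otimes>\<^bsub>A\<^esub> b,
           lact a u \<otimes>\<^bsub>K\<^esub> ract x (circ b u),
           lact (circ a x) v \<otimes>\<^bsub>K\<^esub> ract y (circ (circ b u) v))),
        one = (\<one>\<^bsub>A\<^esub>, \<one>\<^bsub>K\<^esub>, \<one>\<^bsub>K\<^esub>)\<rparr>"

definition bowtie_s00 :: "('k, 'n) monoid_scheme \<Rightarrow> 'a \<Rightarrow> 'a \<times> 'k"
  where "bowtie_s00 K = (\<lambda>a. (a, \<one>\<^bsub>K\<^esub>))"

definition bowtie_s10 :: "('k, 'n) monoid_scheme \<Rightarrow> 'a \<times> 'k \<Rightarrow> 'a \<times> 'k \<times> 'k"
  where "bowtie_s10 K = (\<lambda>(a, x). (a, x, \<one>\<^bsub>K\<^esub>))"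

definition bowtie_s11 :: "('k, 'n) monoid_scheme \<Rightarrow> 'a \<times> 'k \<Rightarrow> 'a \<times> 'k \<times> 'k"
  where "bowtie_s11 K = (\<lambda>(a, x). (a, \<one>\<^bsub>K\<^esub>, x))"

definition bowtie_d10 :: "'a \<times> 'k \<Rightarrow> 'a"
  where "bowtie_d10 = (\<lambda>(a, x). a)"

definition bowtie_d11 :: "('a \<Rightarrow> 'k \<Rightarrow> 'a) \<Rightarrow> 'a \<times> 'k \<Rightarrow> 'a"
  where "bowtie_d11 circ = (\<lambda>(a, x). circ a x)"

definition bowtie_d20 :: "'a \<times> 'k \<times> 'k \<Rightarrow> 'a \<times> 'k"
  where "bowtie_d20 = (\<lambda>(a, x, y). (a, x))"

definition bowtie_d21 :: "('k, 'n) monoid_scheme \<Rightarrow> 'a \<times> 'k \<times> 'k \<Rightarrow> 'a \<times> 'k"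
  where "bowtie_d21 K = (\<lambda>(a, x, y). (a, x \<otimes>\<^bsub>K\<^esub> y))"

definition bowtie_d22 :: "('a \<Rightarrow> 'k \<Rightarrow> 'a) \<Rightarrow> 'a \<times> 'k \<times> 'k \<Rightarrow> 'a \<times> 'k"
  where "bowtie_d22 circ = (\<lambda>(a, x, y). (circ a x, y))"

end

theory Submission
  imports Defs
begin

text \<open>
  The source map turns axioms (2) and (3) into multiplicativity, so associativity of
  \<open>A \<bowtie> K\<close> follows from axiom (1).  The injective map
  \<open>(a, x, y) \<mapsto> ((a, x), (a \<circ> x, y))\<close> identifies \<open>A \<bowtie> K \<bowtie> K\<close> with the pullback of
  source and target, so its monoid laws, its universal property and the multiplicativity of every
  map into it reduce to \<open>A \<bowtie> K\<close>.  Only the composition needs axiom (4).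
\<close>

lemma monoid_homsI:
  assumes "\<And>x. x \<in> carrier M \<Longrightarrow> h x \<in> carrier N"
    and "\<And>x y. \<lbrakk>x \<in> carrier M; y \<in> carrier M\<rbrakk> \<Longrightarrow> h (x \<otimes>\<^bsub>M\<^esub> y) = h x \<otimes>\<^bsub>N\<^esub> h y"
    and "h \<one>\<^bsub>M\<^esub> = \<one>\<^bsub>N\<^esub>"
  shows "h \<in> monoid_homs M N"
  using assms by (auto simp: monoid_homs_def hom_def)

lemma
  assumes "h \<in> monoid_homs M N"
  shows monoid_homs_closed: "x \<in> carrier M \<Longrightarrow> h x \<in> carrier N"
    and monoid_homs_mult: "\<lbrakk>x \<in> carrier M; y \<in> carrier M\<rbrakk> \<Longrightarrow> h (x \<otimes>\<^bsub>M\<^esub> y) = h x \<otimes>\<^bsub>N\<^esub> h y"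
    and monoid_homs_one: "h \<one>\<^bsub>M\<^esub> = \<one>\<^bsub>N\<^esub>"
  using assms by (auto simp: monoid_homs_def hom_def)

lemma monoid_homs_id: "(\<lambda>x. x) \<in> monoid_homs M M"
  by (auto intro: monoid_homsI)

lemma monoid_homs_compose:
  "\<lbrakk>f \<in> monoid_homs L M; g \<in> monoid_homs M N\<rbrakk> \<Longrightarrow> (\<lambda>x. g (f x)) \<in> monoid_homs L N"
  by (auto simp: monoid_homs_def hom_def Pi_iff)

text \<open>Composites of structure maps are known to agree with familiar homomorphisms only on the
  carrier. Since \<open>M\<close> is a monoid, products and the unit stay in the carrier, so that
  agreement suffices.\<close>

lemma monoid_homs_cong:
  assumes "monoid M" "g \<in> monoid_homs M N" "\<And>x. x \<in> carrier M \<Longrightarrow> f x = g x"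
  shows "f \<in> monoid_homs M N"
proof -
  interpret M: monoid M by fact
  show ?thesis
    using assms by (auto simp: monoid_homs_def hom_def)
qed

lemma
  assumes "monoid X" "monoid Y" "monoid Z" "f \<in> monoid_homs X Z" "g \<in> monoid_homs Y Z"
  shows monoid_monoid_pullback: "monoid (monoid_pullback X Y f g)"
    and fst_monoid_homs: "fst \<in> monoid_homs (monoid_pullback X Y f g) X"
    and snd_monoid_homs: "snd \<in> monoid_homs (monoid_pullback X Y f g) Y"
  using monoid_pullback_square_monoid_pullback[OF assms]
  unfolding monoid_pullback_square_def by blast+

context crossed_semi_bimodule
begin

abbreviation C1 :: "('a \<times> 'k) monoid"
  where "C1 \<equiv> bowtie A K circ lact ract"

abbreviation C2 :: "('a \<times> 'k \<times> 'k) monoid"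
  where "C2 \<equiv> bowtie2 A K circ lact ract"

lemmas bowtie_maps_def = bowtie_s00_def bowtie_s10_def bowtie_s11_def bowtie_d10_def
  bowtie_d11_def bowtie_d20_def bowtie_d21_def bowtie_d22_def

lemmas action_closed [simp] = circ_closed lact_closed ract_closed

lemmas action_simps [simp] = circ_one lact_one_left lact_one ract_one_right ract_one

text \<open>By \<open>circ_mult\<close> the two factors act one after the other:
  \<open>mult_circ_lact\<close> turns the first action into \<open>a \<otimes> circ b y\<close>, and
  \<open>mult_circ_ract\<close>, with \<open>circ b y\<close> in the role of \<open>b\<close>,
  evaluates the second.\<close>

lemma circ_bowtie_mult:
  assumes "a \<in> carrier A" "b \<in> carrier A" "x \<in> carrier K" "y \<in> carrier K"
  shows "circ (a \<otimes>\<^bsub>A\<^esub> b) (lact a y \<otimes>\<^bsub>K\<^esub> ract x (circ b y)) = circ a x \<otimes>\<^bsub>A\<^esub> circ b y"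
  using assms by (simp add: circ_mult mult_circ_lact mult_circ_ract)

lemma monoid_bowtie: "monoid C1"
proof (rule monoidI)
  fix f g h
  assume "f \<in> carrier C1" "g \<in> carrier C1" "h \<in> carrier C1"
  then show "f \<otimes>\<^bsub>C1\<^esub> g \<otimes>\<^bsub>C1\<^esub> h = f \<otimes>\<^bsub>C1\<^esub> (g \<otimes>\<^bsub>C1\<^esub> h)"
    \<comment> \<open>On \<open>(a, x)\<close>, \<open>(b, y)\<close>, \<open>(c, z)\<close> both
      \<open>K\<close>-entries are threefold products with outer factors
      \<open>lact a (lact b z)\<close> and \<open>ract (ract x (circ b y)) (circ c z)\<close>;
      \<open>circ_bowtie_mult\<close> computes the exponent of \<open>x\<close> in the right-hand
      bracketing. The middle factors \<open>ract (lact a y) (circ c z)\<close> and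
      \<open>lact a (ract y (circ c z))\<close> agree by \<open>lact_ract\<close>.\<close>
    by (auto simp: bowtie_def circ_bowtie_mult A.m_assoc K.m_assoc lact_mult lact_mult_left
        ract_mult ract_mult_right lact_ract)
qed (auto simp: bowtie_def)

lemma s00_hom: "bowtie_s00 K \<in> monoid_homs A C1"
  by (rule monoid_homsI) (auto simp: bowtie_def bowtie_s00_def)

lemma d10_hom: "bowtie_d10 \<in> monoid_homs C1 A"
  by (rule monoid_homsI) (auto simp: bowtie_def bowtie_d10_def)

lemma d11_hom: "bowtie_d11 circ \<in> monoid_homs C1 A"
  by (rule monoid_homsI) (auto simp: bowtie_def bowtie_d11_def circ_bowtie_mult)

lemma d20_hom: "bowtie_d20 \<in> monoid_homs C2 C1"
  by (rule monoid_homsI) (auto simp: bowtie_def bowtie2_def bowtie_d20_def)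

lemma d22_hom: "bowtie_d22 circ \<in> monoid_homs C2 C1"
  by (rule monoid_homsI)
    (auto simp: bowtie_def bowtie2_def bowtie_d22_def circ_bowtie_mult)

text \<open>\<open>bowtie_d20\<close> keeps the first two entries of a triple and
  \<open>bowtie_d22 circ\<close> keeps the third. Equations in \<open>C2\<close> can therefore be
  tested in \<open>C1\<close>.\<close>

lemma d20_d22_inject:
  "\<lbrakk>bowtie_d20 v = bowtie_d20 w; bowtie_d22 circ v = bowtie_d22 circ w\<rbrakk> \<Longrightarrow> v = w"
  by (auto simp: bowtie_d20_def bowtie_d22_def split: prod.splits)

lemma bowtie2_mult_closed:
  "\<lbrakk>v \<in> carrier C2; w \<in> carrier C2\<rbrakk> \<Longrightarrow> v \<otimes>\<^bsub>C2\<^esub> w \<in> carrier C2"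
  by (auto simp: bowtie2_def)

lemma monoid_bowtie2: "monoid C2"
proof (rule monoidI)
  fix u v w
  assume uvw: "u \<in> carrier C2" "v \<in> carrier C2" "w \<in> carrier C2"
  \<comment> \<open>\<open>monoid_homs\<close> refers only to carriers and operations, so the faces
    are homomorphisms before \<open>C2\<close> is known to be a monoid; associativity of
    \<open>C1\<close> makes them agree on the two bracketings.\<close>
  have "p (u \<otimes>\<^bsub>C2\<^esub> v \<otimes>\<^bsub>C2\<^esub> w) = p (u \<otimes>\<^bsub>C2\<^esub> (v \<otimes>\<^bsub>C2\<^esub> w))" if p: "p \<in> monoid_homs C2 C1" for p
    using uvw monoid.m_assoc[OF monoid_bowtie]
    by (simp add: bowtie2_mult_closed monoid_homs_mult[OF p] monoid_homs_closed[OF p])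
  then show "u \<otimes>\<^bsub>C2\<^esub> v \<otimes>\<^bsub>C2\<^esub> w = u \<otimes>\<^bsub>C2\<^esub> (v \<otimes>\<^bsub>C2\<^esub> w)"
    using d20_hom d22_hom by (blast intro: d20_d22_inject)
qed (auto simp: bowtie2_def)

text \<open>Both faces preserve products and units, so applying them to the required equations for
  \<open>h\<close> yields exactly those for the two composites, and \<open>d20_d22_inject\<close>
  leads back.\<close>

lemma into_bowtie2_hom:
  assumes closed: "\<And>t. t \<in> carrier T \<Longrightarrow> h t \<in> carrier C2"
    and d20h: "(\<lambda>t. bowtie_d20 (h t)) \<in> monoid_homs T C1"
    and d22h: "(\<lambda>t. bowtie_d22 circ (h t)) \<in> monoid_homs T C1"
  shows "h \<in> monoid_homs T C2"
proof (rule monoid_homsI)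
  fix s t
  assume "s \<in> carrier T" "t \<in> carrier T"
  then show "h (s \<otimes>\<^bsub>T\<^esub> t) = h s \<otimes>\<^bsub>C2\<^esub> h t"
    using closed monoid_homs_mult[OF d20h] monoid_homs_mult[OF d22h]
    by (intro d20_d22_inject)
      (simp_all add: monoid_homs_mult[OF d20_hom] monoid_homs_mult[OF d22_hom])
next
  show "h \<one>\<^bsub>T\<^esub> = \<one>\<^bsub>C2\<^esub>"
    using monoid_homs_one[OF d20h] monoid_homs_one[OF d22h]
    by (intro d20_d22_inject)
      (simp_all add: monoid_homs_one[OF d20_hom] monoid_homs_one[OF d22_hom])
qed (fact closed)

lemma simplicial_identities_bowtie:
  "simplicial_identities A C1 C2 (bowtie_s00 K) (bowtie_s10 K) (bowtie_s11 K)
     bowtie_d10 (bowtie_d11 circ) bowtie_d20 (bowtie_d21 K) (bowtie_d22 circ)"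
  by (auto simp: simplicial_identities_def bowtie_def bowtie2_def bowtie_maps_def circ_mult)

text \<open>The simplicial identities are plain equations and already identify the faces of this
  map: the identity, and \<open>bowtie_s00 K\<close> after the source map.\<close>

lemma s10_hom: "bowtie_s10 K \<in> monoid_homs C1 C2"
proof (rule into_bowtie2_hom)
  show "(\<lambda>f. bowtie_d20 (bowtie_s10 K f)) \<in> monoid_homs C1 C1"
    using simplicial_identities_bowtie
    by (intro monoid_homs_cong[OF monoid_bowtie monoid_homs_id])
      (simp add: simplicial_identities_def)
  show "(\<lambda>f. bowtie_d22 circ (bowtie_s10 K f)) \<in> monoid_homs C1 C1"
    using simplicial_identities_bowtie
    by (intro monoid_homs_cong[OF monoid_bowtie monoid_homs_compose[OF d11_hom s00_hom]])
      (simp add: simplicial_identities_def)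
qed (auto simp: bowtie_def bowtie2_def bowtie_s10_def)

lemma s11_hom: "bowtie_s11 K \<in> monoid_homs C1 C2"
proof (rule into_bowtie2_hom)
  show "(\<lambda>f. bowtie_d20 (bowtie_s11 K f)) \<in> monoid_homs C1 C1"
    using simplicial_identities_bowtie
    by (intro monoid_homs_cong[OF monoid_bowtie monoid_homs_compose[OF d10_hom s00_hom]])
      (simp add: simplicial_identities_def)
  show "(\<lambda>f. bowtie_d22 circ (bowtie_s11 K f)) \<in> monoid_homs C1 C1"
    using simplicial_identities_bowtie
    by (intro monoid_homs_cong[OF monoid_bowtie monoid_homs_id])
      (simp add: simplicial_identities_def)
qed (auto simp: bowtie_def bowtie2_def bowtie_s11_def)

text \<open>The action laws leave the outer factors \<open>lact a u\<close> and
  \<open>ract y (circ (circ b u) v)\<close> in place, and only the inner two must be exchanged. This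
  is the \<open>K\<close>-entry of multiplicativity of \<open>bowtie_d21 K\<close>.\<close>

lemma lact_mult_ract_circ_mult:
  assumes "a \<in> carrier A" "b \<in> carrier A"
    and "x \<in> carrier K" "y \<in> carrier K" "u \<in> carrier K" "v \<in> carrier K"
  shows "lact a (u \<otimes>\<^bsub>K\<^esub> v) \<otimes>\<^bsub>K\<^esub> ract (x \<otimes>\<^bsub>K\<^esub> y) (circ b (u \<otimes>\<^bsub>K\<^esub> v)) =
    (lact a u \<otimes>\<^bsub>K\<^esub> ract x (circ b u)) \<otimes>\<^bsub>K\<^esub>
    (lact (circ a x) v \<otimes>\<^bsub>K\<^esub> ract y (circ (circ b u) v))"
proof -
  let ?c = "circ (circ b u) v"
  have "lact a (u \<otimes>\<^bsub>K\<^esub> v) \<otimes>\<^bsub>K\<^esub> ract (x \<otimes>\<^bsub>K\<^esub> y) (circ b (u \<otimes>\<^bsub>K\<^esub> v)) =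
      lact a u \<otimes>\<^bsub>K\<^esub> (lact a v \<otimes>\<^bsub>K\<^esub> ract x ?c) \<otimes>\<^bsub>K\<^esub> ract y ?c"
    using assms by (simp add: lact_mult ract_mult circ_mult K.m_assoc)
  \<comment> \<open>This is \<open>interchange\<close> with \<open>circ b u\<close> for
    \<open>b\<close> and \<open>v\<close> for \<open>y\<close>.\<close>
  also have "lact a v \<otimes>\<^bsub>K\<^esub> ract x ?c = ract x (circ b u) \<otimes>\<^bsub>K\<^esub> lact (circ a x) v"
    using assms by (simp add: interchange)
  finally show ?thesis
    using assms by (simp add: K.m_assoc)
qed

lemma d21_hom: "bowtie_d21 K \<in> monoid_homs C2 C1"
  by (rule monoid_homsI)
    (auto simp: bowtie_def bowtie2_def bowtie_d21_def lact_mult_ract_circ_mult)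

lemma pullback_bowtie2:
  "monoid_pullback_square TYPE('t) C2 C1 C1 A
     bowtie_d20 (bowtie_d22 circ) (bowtie_d11 circ) bowtie_d10"
proof -
  have "\<exists>h \<in> monoid_homs T C2.
          (\<forall>t \<in> carrier T. bowtie_d20 (h t) = u t \<and> bowtie_d22 circ (h t) = v t) \<and>
          (\<forall>h' \<in> monoid_homs T C2.
             (\<forall>t \<in> carrier T. bowtie_d20 (h' t) = u t \<and> bowtie_d22 circ (h' t) = v t) \<longrightarrow>
             (\<forall>t \<in> carrier T. h' t = h t))"
    if T: "monoid T" and u: "u \<in> monoid_homs T C1" and v: "v \<in> monoid_homs T C1"
      and uv: "\<forall>t \<in> carrier T. bowtie_d11 circ (u t) = bowtie_d10 (v t)"
    for T :: "'t monoid" and u v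
  proof -
    \<comment> \<open>The witness is forced: \<open>bowtie_d20\<close> prescribes the first two
      entries and \<open>bowtie_d22 circ\<close> the third.\<close>
    define h where "h t = (fst (u t), snd (u t), snd (v t))" for t
    have d20h: "bowtie_d20 (h t) = u t" for t
      by (simp add: h_def bowtie_d20_def)
    \<comment> \<open>The first entry is \<open>circ (fst (u t)) (snd (u t))\<close>, which the
      commuting square equates with \<open>fst (v t)\<close>, for \<open>t\<close> in the carrier
      only.\<close>
    have d22h: "bowtie_d22 circ (h t) = v t" if "t \<in> carrier T" for t
      using uv that
      by (auto simp: h_def bowtie_d10_def bowtie_d11_def bowtie_d22_def prod_eq_iff case_prod_unfold)
    have "h \<in> monoid_homs T C2"
    proof (rule into_bowtie2_hom)
      fix t
      assume "t \<in> carrier T"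
      then show "h t \<in> carrier C2"
        using monoid_homs_closed[OF u] monoid_homs_closed[OF v]
        by (auto simp: h_def bowtie_def bowtie2_def mem_Times_iff)
    next
      show "(\<lambda>t. bowtie_d20 (h t)) \<in> monoid_homs T C1"
        using u by (simp add: d20h)
      show "(\<lambda>t. bowtie_d22 circ (h t)) \<in> monoid_homs T C1"
        by (rule monoid_homs_cong[OF T v d22h])
    qed
    then show ?thesis
      using d20h d22h by (intro bexI[of _ h]) (auto intro: d20_d22_inject)
  qed
  moreover have "\<forall>w \<in> carrier C2. bowtie_d11 circ (bowtie_d20 w) = bowtie_d10 (bowtie_d22 circ w)"
    using simplicial_identities_bowtie by (simp add: simplicial_identities_def)
  ultimately show ?thesis
    unfolding monoid_pullback_square_def
    using monoid_bowtie monoid_bowtie2 A.monoid_axioms d20_hom d22_hom d11_hom d10_hom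
    by blast
qed

lemma composition_assoc_bowtie2:
  "composition_assoc C2 bowtie_d20 (bowtie_d21 K) (bowtie_d22 circ)"
proof -
  let ?C3 = "monoid_pullback C2 C2 (bowtie_d22 circ) bowtie_d20"
  \<comment> \<open>Membership in \<open>?C3\<close> means \<open>b = circ a x\<close> and
    \<open>u = y\<close>, so an element is a chain given by \<open>a\<close>, \<open>x\<close>,
    \<open>y\<close>, \<open>v\<close>. \<open>d31\<close> multiplies the last two
    \<open>K\<close>-entries and \<open>d32\<close> the first two.\<close>
  define d31 :: "('a \<times> 'k \<times> 'k) \<times> ('a \<times> 'k \<times> 'k) \<Rightarrow> 'a \<times> 'k \<times> 'k"
    where "d31 = (\<lambda>((a, x, y), (b, u, v)). (a, x, y \<otimes>\<^bsub>K\<^esub> v))"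
  define d32 :: "('a \<times> 'k \<times> 'k) \<times> ('a \<times> 'k \<times> 'k) \<Rightarrow> 'a \<times> 'k \<times> 'k"
    where "d32 = (\<lambda>((a, x, y), (b, u, v)). (a, x \<otimes>\<^bsub>K\<^esub> y, v))"
  note C3 = monoid_bowtie2 monoid_bowtie2 monoid_bowtie d22_hom d20_hom
  note monoid_C3 = monoid_monoid_pullback[OF C3]
  note fst_hom = fst_monoid_homs[OF C3] and snd_hom = snd_monoid_homs[OF C3]
  \<comment> \<open>Associativity of \<open>K\<close> gives the associative law for composition, and
    \<open>circ_mult\<close> matches the sources in the last equation.\<close>
  have ids: "d31 w \<in> carrier C2" "d32 w \<in> carrier C2"
      "bowtie_d20 (d31 w) = bowtie_d20 (fst w)"
      "bowtie_d20 (d32 w) = bowtie_d21 K (fst w)"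
      "bowtie_d20 (snd w) = bowtie_d22 circ (fst w)"
      "bowtie_d21 K (d32 w) = bowtie_d21 K (d31 w)"
      "bowtie_d21 K (snd w) = bowtie_d22 circ (d31 w)"
      "bowtie_d22 circ (snd w) = bowtie_d22 circ (d32 w)"
    if "w \<in> carrier ?C3" for w
    using that
    by (auto simp: monoid_pullback_def DirProd_def bowtie2_def bowtie_maps_def d31_def d32_def
        circ_mult K.m_assoc)
  \<comment> \<open>By \<open>ids\<close> the faces of \<open>d31\<close> are
    \<open>bowtie_d20\<close> after \<open>fst\<close> and \<open>bowtie_d21 K\<close> after
    \<open>snd\<close>, so multiplicativity of composition enters here.\<close>
  have "d31 \<in> monoid_homs ?C3 C2"
  proof (rule into_bowtie2_hom)
    show "(\<lambda>w. bowtie_d20 (d31 w)) \<in> monoid_homs ?C3 C1"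
      by (rule monoid_homs_cong[OF monoid_C3 monoid_homs_compose[OF fst_hom d20_hom]])
        (simp add: ids)
    show "(\<lambda>w. bowtie_d22 circ (d31 w)) \<in> monoid_homs ?C3 C1"
      by (rule monoid_homs_cong[OF monoid_C3 monoid_homs_compose[OF snd_hom d21_hom]])
        (simp add: ids)
  qed (fact ids)
  moreover have "d32 \<in> monoid_homs ?C3 C2"
  proof (rule into_bowtie2_hom)
    show "(\<lambda>w. bowtie_d20 (d32 w)) \<in> monoid_homs ?C3 C1"
      by (rule monoid_homs_cong[OF monoid_C3 monoid_homs_compose[OF fst_hom d21_hom]])
        (simp add: ids)
    show "(\<lambda>w. bowtie_d22 circ (d32 w)) \<in> monoid_homs ?C3 C1"
      by (rule monoid_homs_cong[OF monoid_C3 monoid_homs_compose[OF snd_hom d22_hom]])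
        (simp add: ids)
  qed (fact ids)
  ultimately show ?thesis
    unfolding composition_assoc_def Let_def
    by (intro bexI[of _ d31] bexI[of _ d32] ballI conjI ids)
qed

end

theorem proposition3p6:
  fixes A :: "('a, 'm) monoid_scheme" and K :: "('k, 'n) monoid_scheme"
    and circ :: "'a \<Rightarrow> 'k \<Rightarrow> 'a" and lact :: "'a \<Rightarrow> 'k \<Rightarrow> 'k" and ract :: "'k \<Rightarrow> 'a \<Rightarrow> 'k"
  assumes "crossed_semi_bimodule A K circ lact ract"
  shows
    "monoid (bowtie A K circ lact ract) \<and>
     monoid (bowtie2 A K circ lact ract) \<and>
     (bowtie_s00 K \<in> monoid_homs A (bowtie A K circ lact ract) \<and>
      bowtie_s10 K \<in> monoid_homs (bowtie A K circ lact ract) (bowtie2 A K circ lact ract) \<and>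
      bowtie_s11 K \<in> monoid_homs (bowtie A K circ lact ract) (bowtie2 A K circ lact ract) \<and>
      bowtie_d10 \<in> monoid_homs (bowtie A K circ lact ract) A \<and>
      bowtie_d11 circ \<in> monoid_homs (bowtie A K circ lact ract) A \<and>
      bowtie_d20 \<in> monoid_homs (bowtie2 A K circ lact ract) (bowtie A K circ lact ract) \<and>
      bowtie_d21 K \<in> monoid_homs (bowtie2 A K circ lact ract) (bowtie A K circ lact ract) \<and>
      bowtie_d22 circ \<in> monoid_homs (bowtie2 A K circ lact ract) (bowtie A K circ lact ract) \<and>
      simplicial_identities A (bowtie A K circ lact ract) (bowtie2 A K circ lact ract)
        (bowtie_s00 K) (bowtie_s10 K) (bowtie_s11 K)
        bowtie_d10 (bowtie_d11 circ) bowtie_d20 (bowtie_d21 K) (bowtie_d22 circ)) \<and>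
     monoid_pullback_square TYPE('t)
       (bowtie2 A K circ lact ract) (bowtie A K circ lact ract) (bowtie A K circ lact ract) A
       bowtie_d20 (bowtie_d22 circ) (bowtie_d11 circ) bowtie_d10 \<and>
     internal_category_in_monoids TYPE('t)
       A (bowtie A K circ lact ract) (bowtie2 A K circ lact ract)
       (bowtie_s00 K) (bowtie_s10 K) (bowtie_s11 K)
       bowtie_d10 (bowtie_d11 circ) bowtie_d20 (bowtie_d21 K) (bowtie_d22 circ)"
proof -
  interpret crossed_semi_bimodule A K circ lact ract by fact
  show ?thesis
    unfolding internal_category_in_monoids_def
    by (intro conjI monoid_bowtie monoid_bowtie2 A.monoid_axioms s00_hom s10_hom s11_hom
        d10_hom d11_hom d20_hom d21_hom d22_hom simplicial_identities_bowtie pullback_bowtie2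
        composition_assoc_bowtie2)
qed

end
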